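(* Let $X,N$ be two normed linear spaces over the field $\mathbb K$ ($\mathbb K=\mathbb R$ or $\mathbb C$) with $X$ separable, and regard $X$ as the topological measure space $(X,\|\cdot\|,\mathscr A,\mu)$. Then a linear transformation $T:X\to N$ is absolutely continuous if and only if $T$ is bounded.
   Context: The structure on $X$: $X$ carries its norm topology and norm metric. Define $\nu:2^X\to[0,\infty]$ by $\nu(A):=\inf\{\sum_{n\in\mathbb N}\operatorname{diam}(B_n): A\subseteq\bigcup_{n\in\mathbb N}B_n,\ B_n\text{ open for all }n\}$. A set $A\subseteq X$ is $\nu$-measurable if $\nu(D)=\nu(D\cap A)+\nu(D\smallsetminus A)$ for all $D\subseteq X$; $\mathscr A$ is the $\sigma$-algebra of $\nu$-measurable sets and $\mu:=\nu|_{\mathscr A}$. Given a topological space $(X,\tau)$ and a measure space $(X,\mathscr M,m)$, $(X,\tau,\mathscr M,m)$ is called a topological measure space (tms) if: (i) $\mathscr M$ contains all open sets; (ii) for every $x\in X$ and $\varepsilon>0$ there is an open connected neighbourhood $U$ of $x$ with $m(U)<\varepsilon$; (iii) for every open $G$ and $x\in G$ there is $\varepsilon>0$ such that every open connected neighbourhood $U$ of $x$ with $m(U)<\varepsilon$ satisfies $U\subseteq G$. In the paper $(X,\|\cdot\|,\mathscr A,\mu)$ is regarded as a tms for every separable normed linear space $X$. For $\delta>0$, $\mathcal P_\delta$ denotes the collection of all countable (finite or infinite) families $\{E_i\}_i$ of pairwise disjoint open connected subsets of $X$ with $\sum_i \mu(E_i)<\delta$. A function $f:X\to N$ is absolutely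 continuous if for every $\varepsilon>0$ there exists $\delta>0$ such that for every $\{D_i\}_i\in\mathcal P_\delta$ one has $\sum_i\omega(f,D_i)<\varepsilon$, where $\omega(f,D):=\sup\{\|f(x)-f(y)\|:x,y\in D\}$.
   Formalization: In the definition of absolute continuity, μ(E_i) is replaced by ν(E_i) for all open connected E_i, with no ν-measurability required: in real dimension at least 2 nonempty bounded open sets are not ν-measurable, so X is not a topological measure space and μ(E_i) is undefined. *)

theory Defs
  imports "HOL-Analysis.Analysis"
begin

(* A normed space over K. By the Gelfand-Mazur theorem the types of class real_normed_field are,
   up to isometric isomorphism, exactly real and complex. The norm is that of the underlying
   real_normed_vector type; the last assumption says that *\<^sub>R is the restriction of the
   K-scalar multiplication to real scalars. *)
locale normed_space_over = vector_space scale
  for scale :: "'k::real_normed_field \<Rightarrow> 'a::real_normed_vector \<Rightarrow> 'a" +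
  assumes norm_scale: "norm (scale c x) = norm c * norm x"
    and scale_of_real: "scale (of_real r) x = r *\<^sub>R x"

(* Extended-real-valued, since diameter takes an unspecified value on unbounded sets.
   The diameter of the empty set is 0. *)
definition ediam :: "'a::metric_space set \<Rightarrow> ennreal" where
  "ediam A = (SUP x\<in>A. SUP y\<in>A. ennreal (dist x y))"

definition nu :: "'a::metric_space set \<Rightarrow> ennreal" where
  "nu A = Inf {(\<Sum>n. ediam (B n)) | B :: nat \<Rightarrow> 'a set.
                 (\<forall>n. open (B n)) \<and> A \<subseteq> (\<Union>n. B n)}"

definition oscillation :: "('a \<Rightarrow> 'b::real_normed_vector) \<Rightarrow> 'a set \<Rightarrow> ennreal" where
  "oscillation f D = (SUP x\<in>D. SUP y\<in>D. ennreal (norm (f x - f y)))"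

(* The families P_delta, as sequences: a finite family is padded with empty sets, which are open,
   connected and disjoint from everything, and have nu-value and oscillation 0.

   The set function m is total. The measure mu is the restriction of nu to the
   Caratheodory-measurable sets, so mu (E n) is the value m (E n) for m = nu. No membership of
   E n in the sigma-algebra is demanded: all open connected sets are admitted, and
   nu is not replaced by a default value off the sigma-algebra. This matters because, in real
   dimension at least 2, a nonempty bounded open U inside ball 0 r is not nu-measurable: for
   D = ball 0 R with R > r one has nu D = nu (D - U) = 2 * R but nu (D \<inter> U) > 0. *)
definition small_families ::
  "('a::topological_space set \<Rightarrow> ennreal) \<Rightarrow> real \<Rightarrow> (nat \<Rightarrow> 'a set) set" where
  "small_families m \<delta> = {E. disjoint_family E \<and> (\<forall>n. open (E n) \<and> connected (E n)) \<and>
                            (\<Sum>n. m (E n)) < ennreal \<delta>}"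

definition abs_continuous ::
  "('a::topological_space set \<Rightarrow> ennreal) \<Rightarrow> ('a \<Rightarrow> 'b::real_normed_vector) \<Rightarrow> bool" where
  "abs_continuous m f \<longleftrightarrow>
     (\<forall>\<epsilon>>0. \<exists>\<delta>>0. \<forall>D \<in> small_families m \<delta>. (\<Sum>n. oscillation f (D n)) < ennreal \<epsilon>)"

end

theory Submission
  imports Defs
begin

text \<open>
  Everything rests on the identity \<open>nu U = ediam U\<close> for open connected \<open>U\<close>, of which
  the two directions of the theorem use one inequality each.

  For the upper bound an open set covers itself. For the lower bound, fix \<open>x\<close> and \<open>y\<close> in a
  connected set \<open>A\<close> covered by sets \<open>B n\<close>. The function \<open>dist x\<close> is 1-Lipschitz and maps \<open>A\<close>
  onto a connected set of reals containing \<open>0\<close> and \<open>dist x y\<close>, hence the whole interval between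
  them. The images of the \<open>B n\<close> cover this interval and have no larger diameters, so countable
  subadditivity of Lebesgue measure gives \<open>dist x y \<le> (\<Sum>n. ediam (B n))\<close>.

  If \<open>T\<close> is bounded by \<open>K\<close>, then the oscillation of \<open>T\<close> on a set is at most \<open>K\<close> times its
  diameter, and so on open connected sets at most \<open>K\<close> times \<open>nu\<close>; absolute continuity follows
  with \<open>\<delta> = \<epsilon> / K\<close>. Conversely, a small ball is by itself a family in \<open>small_families nu \<delta>\<close>,
  so an absolutely continuous \<open>T\<close> has finite oscillation on some ball around \<open>0\<close>, and homogeneity
  turns this into a bound.
\<close>

section \<open>The set function on connected sets\<close>

lemma dist_le_ediam:
  assumes "x \<in> A" "y \<in> A"
  shows "ennreal (dist x y) \<le> ediam A"
  unfolding ediam_def by (rule SUP_upper2[OF assms(1)], rule SUP_upper2[OF assms(2)], simp)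

lemma ediam_least:
  assumes "\<And>x y. x \<in> A \<Longrightarrow> y \<in> A \<Longrightarrow> ennreal (dist x y) \<le> e"
  shows "ediam A \<le> e"
  unfolding ediam_def using assms by (intro SUP_least)

lemma ediam_image_le:
  assumes "\<And>x y. x \<in> A \<Longrightarrow> y \<in> A \<Longrightarrow> dist (f x) (f y) \<le> dist x y"
  shows "ediam (f ` A) \<le> ediam A"
proof (rule ediam_least)
  fix u v assume "u \<in> f ` A" "v \<in> f ` A"
  then obtain x y where xy: "x \<in> A" "y \<in> A" and uv: "u = f x" "v = f y" by blast
  have "ennreal (dist u v) \<le> ennreal (dist x y)"
    using assms[OF xy] uv by (simp add: ennreal_leI)
  also have "\<dots> \<le> ediam A" by (rule dist_le_ediam[OF xy])
  finally show "ennreal (dist u v) \<le> ediam A" .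
qed

text \<open>For nonempty bounded \<open>S\<close>, the interval from \<open>Inf S\<close> to \<open>Sup S\<close> has length the diameter
  of \<open>S\<close>. Passing to a Borel hull lets Lebesgue measure be applied to sets \<open>S\<close> that need not be measurable.\<close>

lemma real_set_borel_hull:
  fixes S :: "real set"
  obtains H where "H \<in> sets borel" "S \<subseteq> H" "emeasure lborel H \<le> ediam S"
proof (cases "S = {} \<or> ediam S = top")
  case True
  then show thesis
    using that[of "if S = {} then {} else UNIV"] by auto
next
  case False
  define e where "e = enn2real (ediam S)"
  have e: "ediam S = ennreal e" and "0 \<le> e"
    using False by (auto simp: e_def less_top)
  have ne: "S \<noteq> {}" using False by simp
  have d: "dist s t \<le> e" if "s \<in> S" "t \<in> S" for s t
    using dist_le_ediam[OF that] \<open>0 \<le> e\<close> by (simp add: e)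
  have "bounded S"
    using ne d unfolding bounded_def by blast
  then have bdd: "bdd_above S" "bdd_below S"
    by (auto intro: bounded_imp_bdd_above bounded_imp_bdd_below)
  have "Sup S \<le> Inf S + e"
  proof (rule cSup_least[OF ne])
    fix s assume s: "s \<in> S"
    have "s - e \<le> Inf S"
    proof (rule cInf_greatest[OF ne])
      fix t assume "t \<in> S"
      from d[OF s this] show "s - e \<le> t" by (simp add: dist_real_def abs_le_iff)
    qed
    then show "s \<le> Inf S + e" by simp
  qed
  moreover have "Inf S \<le> Sup S"
    by (rule cInf_le_cSup[OF ne bdd])
  ultimately have "emeasure lborel {Inf S..Sup S} \<le> ediam S"
    unfolding e by (simp add: ennreal_leI)
  moreover have "S \<subseteq> {Inf S..Sup S}"
    using bdd by (auto intro: cInf_lower cSup_upper)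
  ultimately show thesis
    using that[of "{Inf S..Sup S}"] by simp
qed

lemma interval_cover_le_sum_ediam:
  fixes S :: "nat \<Rightarrow> real set"
  assumes "{0..d} \<subseteq> (\<Union>n. S n)"
  shows "ennreal d \<le> (\<Sum>n. ediam (S n))"
proof (cases "0 \<le> d")
  case True
  have "\<forall>n. \<exists>H. H \<in> sets borel \<and> S n \<subseteq> H \<and> emeasure lborel H \<le> ediam (S n)"
    by (meson real_set_borel_hull)
  then obtain H where H: "\<And>n. H n \<in> sets borel" "\<And>n. S n \<subseteq> H n"
    "\<And>n. emeasure lborel (H n) \<le> ediam (S n)"
    by metis
  have "ennreal d = emeasure lborel {0..d}" using True by simp
  also have "\<dots> \<le> emeasure lborel (\<Union>n. H n)"
    using assms H(1,2) by (intro emeasure_mono) fastforce+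
  also have "\<dots> \<le> (\<Sum>n. emeasure lborel (H n))"
    using H(1) by (intro emeasure_subadditive_countably) auto
  also have "\<dots> \<le> (\<Sum>n. ediam (S n))"
    by (intro suminf_le H(3)) auto
  finally show ?thesis .
qed (simp add: ennreal_neg)

text \<open>A connected set cannot be covered more cheaply than by its own diameter: \<open>dist x\<close> projects
  it onto an interval without increasing the diameters of the covering sets.\<close>

lemma connected_ediam_le_nu:
  fixes A :: "'a::metric_space set"
  assumes "connected A"
  shows "ediam A \<le> nu A"
  unfolding nu_def
proof (rule Inf_greatest)
  fix s assume "s \<in> {(\<Sum>n. ediam (B n)) | B :: nat \<Rightarrow> 'a set. (\<forall>n. open (B n)) \<and> A \<subseteq> (\<Union>n. B n)}"
  then obtain B where s: "s = (\<Sum>n. ediam (B n))" and cover: "A \<subseteq> (\<Union>n. B n)" by blast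
  show "ediam A \<le> s"
  proof (rule ediam_least)
    fix x y assume xy: "x \<in> A" "y \<in> A"
    have "connected (dist x ` A)"
      by (intro connected_continuous_image continuous_intros assms)
    moreover have "0 \<in> dist x ` A" "dist x y \<in> dist x ` A"
      using xy by (auto intro: image_eqI[of _ _ x])
    ultimately have "{0..dist x y} \<subseteq> dist x ` A"
      by (rule connected_contains_Icc)
    also have "\<dots> \<subseteq> (\<Union>n. dist x ` B n)"
      using cover by blast
    finally have "ennreal (dist x y) \<le> (\<Sum>n. ediam (dist x ` B n))"
      by (rule interval_cover_le_sum_ediam)
    also have "\<dots> \<le> (\<Sum>n. ediam (B n))"
    proof (intro suminf_le ediam_image_le)
      show "dist (dist x u) (dist x v) \<le> dist u v" for u v
        using dist_triangle[of x u v] dist_triangle[of x v u]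
        by (simp add: dist_real_def dist_commute abs_le_iff)
    qed auto
    finally show "ennreal (dist x y) \<le> s" unfolding s .
  qed
qed

lemma suminf_padded:
  fixes f :: "'a set \<Rightarrow> ennreal"
  assumes "f {} = 0"
  shows "(\<Sum>n. f (if n = (0::nat) then A else {})) = f A"
proof -
  have "(\<Sum>n. f (if n = (0::nat) then A else {})) = (\<Sum>n\<in>{0}. f (if n = (0::nat) then A else {}))"
    by (rule suminf_finite) (auto simp: assms)
  then show ?thesis by simp
qed

lemma open_nu_le_ediam:
  assumes "open A"
  shows "nu A \<le> ediam A"
proof -
  have "(\<Sum>n. ediam (if n = (0::nat) then A else {})) = ediam A"
    by (rule suminf_padded) (simp add: ediam_def bot_ennreal)
  then show ?thesis
    unfolding nu_def
    by (intro Inf_lower CollectI exI[of _ "\<lambda>n. if n = (0::nat) then A else {}"])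
      (use assms in \<open>auto split: if_splits\<close>)
qed

section \<open>Oscillation of absolutely continuous and of Lipschitz functions\<close>

lemma norm_diff_le_oscillation:
  assumes "x \<in> D" "y \<in> D"
  shows "ennreal (norm (f x - f y)) \<le> oscillation f D"
  unfolding oscillation_def by (rule SUP_upper2[OF assms(1)], rule SUP_upper2[OF assms(2)], simp)

lemma oscillation_le_ediam:
  assumes "0 \<le> K" and lip: "\<And>x y. norm (f x - f y) \<le> K * dist x y"
  shows "oscillation f D \<le> ennreal K * ediam D"
  unfolding oscillation_def
proof (intro SUP_least)
  fix x y assume xy: "x \<in> D" "y \<in> D"
  have "ennreal (norm (f x - f y)) \<le> ennreal K * ennreal (dist x y)"
    using lip[of x y] \<open>0 \<le> K\<close> by (simp add: ennreal_leI flip: ennreal_mult)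
  also have "\<dots> \<le> ennreal K * ediam D"
    by (intro mult_left_mono dist_le_ediam xy) simp
  finally show "ennreal (norm (f x - f y)) \<le> ennreal K * ediam D" .
qed

lemma lipschitz_imp_abs_continuous:
  fixes f :: "'a::metric_space \<Rightarrow> 'b::real_normed_vector"
  assumes "0 < K" and lip: "\<And>x y. norm (f x - f y) \<le> K * dist x y"
  shows "abs_continuous nu f"
  unfolding abs_continuous_def
proof (intro allI impI)
  fix \<epsilon> :: real assume "0 < \<epsilon>"
  have "(\<Sum>n. oscillation f (D n)) < ennreal \<epsilon>" if D: "D \<in> small_families nu (\<epsilon> / K)" for D
  proof -
    have conn: "connected (D n)" for n
      using D by (simp add: small_families_def)
    have "(\<Sum>n. oscillation f (D n)) \<le> (\<Sum>n. ennreal K * nu (D n))"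
    proof (intro suminf_le)
      fix n
      have "oscillation f (D n) \<le> ennreal K * ediam (D n)"
        using assms by (intro oscillation_le_ediam) auto
      also have "\<dots> \<le> ennreal K * nu (D n)"
        by (intro mult_left_mono connected_ediam_le_nu conn) simp
      finally show "oscillation f (D n) \<le> ennreal K * nu (D n)" .
    qed auto
    also have "\<dots> = ennreal K * (\<Sum>n. nu (D n))"
      by (rule ennreal_suminf_cmult)
    also have "\<dots> < ennreal K * ennreal (\<epsilon> / K)"
      using D \<open>0 < K\<close>
      by (intro ennreal_mult_strict_left_mono) (auto simp: small_families_def)
    also have "\<dots> = ennreal \<epsilon>"
      using \<open>0 < K\<close> \<open>0 < \<epsilon>\<close> by (simp flip: ennreal_mult)
    finally show ?thesis .
  qed
  then show "\<exists>\<delta>>0. \<forall>D\<in>small_families nu \<delta>. (\<Sum>n. oscillation f (D n)) < ennreal \<epsilon>"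
    using \<open>0 < K\<close> \<open>0 < \<epsilon>\<close> by (intro exI[of _ "\<epsilon> / K"]) simp
qed

text \<open>Balls are connected here because the domain is a normed space; a single ball, padded with
  empty sets, is then an admissible family.\<close>

lemma abs_continuous_imp_norm_diff_less_on_ball:
  fixes f :: "'a::real_normed_vector \<Rightarrow> 'b::real_normed_vector"
  assumes ac: "abs_continuous nu f" and "0 < \<epsilon>"
  obtains r where "0 < r" "\<And>x y. x \<in> ball z r \<Longrightarrow> y \<in> ball z r \<Longrightarrow> norm (f x - f y) < \<epsilon>"
proof -
  obtain \<delta> where "0 < \<delta>"
    and small: "\<And>D. D \<in> small_families nu \<delta> \<Longrightarrow> (\<Sum>n. oscillation f (D n)) < ennreal \<epsilon>"
    using ac \<open>0 < \<epsilon>\<close> unfolding abs_continuous_def by blast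
  \<comment> \<open>The ball of radius \<open>r\<close> has diameter at most \<open>2 * r\<close>, which must stay strictly below \<open>\<delta>\<close>.\<close>
  define r where "r = \<delta> / 3"
  define D where "D = (\<lambda>n. if n = (0::nat) then ball z r else {})"
  have "0 < r" "2 * r < \<delta>" using \<open>0 < \<delta>\<close> by (auto simp: r_def)
  have "ediam (ball z r) \<le> ennreal (2 * r)"
  proof (rule ediam_least)
    fix x y assume "x \<in> ball z r" "y \<in> ball z r"
    then have "dist x y \<le> 2 * r"
      using dist_triangle2[of x y z] by (simp add: dist_commute)
    then show "ennreal (dist x y) \<le> ennreal (2 * r)" by (rule ennreal_leI)
  qed
  also have "\<dots> < ennreal \<delta>"
    using \<open>2 * r < \<delta>\<close> \<open>0 < r\<close> by (intro ennreal_lessI) auto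
  finally have "ediam (ball z r) < ennreal \<delta>" .
  moreover have "(\<Sum>n. nu (D n)) \<le> ediam (ball z r)"
  proof -
    have "nu ({} :: 'a set) = 0"
      using open_nu_le_ediam[of "{} :: 'a set"] by (simp add: ediam_def bot_ennreal)
    then have "(\<Sum>n. nu (D n)) = nu (ball z r)"
      unfolding D_def by (rule suminf_padded)
    then show ?thesis using open_nu_le_ediam[of "ball z r"] by simp
  qed
  ultimately have "D \<in> small_families nu \<delta>"
    by (auto simp: small_families_def D_def disjoint_family_on_def)
  then have "(\<Sum>n. oscillation f (D n)) < ennreal \<epsilon>" by (rule small)
  also have "(\<Sum>n. oscillation f (D n)) = oscillation f (ball z r)"
    unfolding D_def by (rule suminf_padded) (simp add: oscillation_def bot_ennreal)
  finally have osc: "oscillation f (ball z r) < ennreal \<epsilon>" .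
  show thesis
  proof (rule that[OF \<open>0 < r\<close>])
    fix x y assume "x \<in> ball z r" "y \<in> ball z r"
    then have "ennreal (norm (f x - f y)) < ennreal \<epsilon>"
      using osc by (intro le_less_trans[OF norm_diff_le_oscillation])
    then show "norm (f x - f y) < \<epsilon>" by (simp add: ennreal_less_iff)
  qed
qed

section \<open>Linear maps\<close>

lemma linear_restrict_scalars:
  assumes "normed_space_over scaleX" "normed_space_over scaleN"
    and "Vector_Spaces.linear scaleX scaleN T"
  shows "linear T"
proof (rule linearI)
  interpret T: Vector_Spaces.linear scaleX scaleN T by fact
  show "T (x + y) = T x + T y" for x y by (rule T.add)
  show "T (c *\<^sub>R x) = c *\<^sub>R T x" for c x
    using T.scale[of "of_real c" x]
    by (simp add: normed_space_over.scale_of_real[OF assms(1)]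
        normed_space_over.scale_of_real[OF assms(2)])
qed

lemma linear_bounded_of_bounded_on_ball:
  fixes T :: "'a::real_normed_vector \<Rightarrow> 'b::real_normed_vector"
  assumes "linear T" "0 < r" and ball: "\<And>x. norm x < r \<Longrightarrow> norm (T x) \<le> M"
  shows "norm (T x) \<le> 2 * M / r * norm x"
proof (cases "x = 0")
  case True
  then show ?thesis using linear_0[OF \<open>linear T\<close>] by simp
next
  case False
  define c where "c = r / (2 * norm x)"
  have "0 < c" using False \<open>0 < r\<close> by (simp add: c_def)
  have "norm (c *\<^sub>R x) < r"
    using False \<open>0 < r\<close> by (simp add: c_def)
  then have "norm (T (c *\<^sub>R x)) \<le> M" by (rule ball)
  then have "c * norm (T x) \<le> M"
    using \<open>0 < c\<close> by (simp add: linear_scale[OF \<open>linear T\<close>])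
  then show ?thesis
    using False \<open>0 < r\<close> by (simp add: c_def field_simps)
qed

theorem theorem5p16:
  fixes scaleX :: "'k::real_normed_field \<Rightarrow> 'x::real_normed_vector \<Rightarrow> 'x"
    and scaleN :: "'k \<Rightarrow> 'n::real_normed_vector \<Rightarrow> 'n"
    and T :: "'x \<Rightarrow> 'n"
  assumes "normed_space_over scaleX"
    and "normed_space_over scaleN"
    and "separable_space (euclidean :: 'x topology)"
    and "Vector_Spaces.linear scaleX scaleN T"
  shows "abs_continuous nu T \<longleftrightarrow> (\<exists>C. \<forall>x. norm (T x) \<le> C * norm x)"
proof -
  have lin: "linear T"
    using assms(1,2,4) by (rule linear_restrict_scalars)
  show ?thesis
  proof
    assume "abs_continuous nu T"
    then obtain r where "0 < r"
      and r: "\<And>x y. x \<in> ball 0 r \<Longrightarrow> y \<in> ball 0 r \<Longrightarrow> norm (T x - T y) < 1"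
      by (rule abs_continuous_imp_norm_diff_less_on_ball[where \<epsilon> = 1 and z = 0]) auto
    have "norm (T x) \<le> 1" if "norm x < r" for x
      using r[of x 0] that \<open>0 < r\<close> linear_0[OF lin] by simp
    then show "\<exists>C. \<forall>x. norm (T x) \<le> C * norm x"
      using linear_bounded_of_bounded_on_ball[OF lin \<open>0 < r\<close>] by blast
  next
    assume "\<exists>C. \<forall>x. norm (T x) \<le> C * norm x"
    then obtain C where C: "\<And>x. norm (T x) \<le> C * norm x" by blast
    \<comment> \<open>\<open>C\<close> may be zero or even negative (when the domain is trivial), so it is enlarged to a
      positive constant.\<close>
    show "abs_continuous nu T"
    proof (rule lipschitz_imp_abs_continuous)
      show "0 < max C 1" by simp
      show "norm (T x - T y) \<le> max C 1 * dist x y" for x y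
      proof -
        have "norm (T x - T y) \<le> C * norm (x - y)"
          using C[of "x - y"] by (simp add: linear_diff[OF lin])
        also have "\<dots> \<le> max C 1 * norm (x - y)"
          by (intro mult_right_mono) auto
        finally show ?thesis by (simp add: dist_norm)
      qed
    qed
  qed
qed

end
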